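(* Let $s,t \geq 1$ be integers and let $\beta_{s,t}$ be the type-$\beta$ comb with $s$ teeth of length $t$. Then the number of linear extensions of $\beta_{s,t}$ that avoid the pattern $231$ equals $t^{s-1}$.
   Context: A linear extension of a finite poset $P$ on a set of integers is a listing $v=[v_1,\dots,v_n]$ of all elements of $P$, each exactly once, such that whenever $a \leq_P b$, $a$ appears before $b$. For $w \in S_3$, a sequence $v$ of distinct integers contains $w$ if there are indices $i<j<k$ with $(v_i,v_j,v_k)$ in the same relative order as $(w_1,w_2,w_3)$; otherwise $v$ avoids $w$. The type-$\beta$ comb $\beta_{s,t}$ is the poset on $\{1,\dots,st\}$ whose order is generated by the relations $ct+1 \leq (c+1)t+1$ for $0 \leq c \leq s-2$ (the spine) and $ct+j \leq ct+j+1$ for $0 \leq c \leq s-1$, $1 \leq j \leq t-1$ (the teeth $\{ct+1,\dots,ct+t\}$). *)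

theory Defs
  imports Main
begin

definition linear_extensions :: "'a set \<Rightarrow> 'a rel \<Rightarrow> 'a list set" where
  "linear_extensions A r =
     {v. distinct v \<and> set v = A \<and>
         (\<forall>i < length v. \<forall>j < length v. (v ! i, v ! j) \<in> r \<longrightarrow> i \<le> j)}"

definition same_relative_order :: "'a::linorder list \<Rightarrow> 'b::linorder list \<Rightarrow> bool" where
  "same_relative_order x y \<longleftrightarrow> length x = length y \<and>
     (\<forall>p < length x. \<forall>q < length x. x ! p < x ! q \<longleftrightarrow> y ! p < y ! q)"

text \<open>A pattern in $S_3$ is given in one-line notation, as a list of length 3.\<close>

definition contains_pattern :: "'a::linorder list \<Rightarrow> nat list \<Rightarrow> bool" where
  "contains_pattern v w \<longleftrightarrow>
     (\<exists>i j k. i < j \<and> j < k \<and> k < length v \<and> same_relative_order [v ! i, v ! j, v ! k] w)"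

abbreviation avoids_pattern :: "'a::linorder list \<Rightarrow> nat list \<Rightarrow> bool" where
  "avoids_pattern v w \<equiv> \<not> contains_pattern v w"

definition comb_spine :: "nat \<Rightarrow> nat \<Rightarrow> nat rel" where
  "comb_spine s t = {(c * t + 1, (c + 1) * t + 1) | c. c + 2 \<le> s}"

definition comb_teeth :: "nat \<Rightarrow> nat \<Rightarrow> nat rel" where
  "comb_teeth s t = {(c * t + j, c * t + j + 1) | c j. c + 1 \<le> s \<and> 1 \<le> j \<and> j + 1 \<le> t}"

definition comb_carrier :: "nat \<Rightarrow> nat \<Rightarrow> nat set" where
  "comb_carrier s t = {1..s * t}"

text \<open>The closure \<open>\<^sup>*\<close> is reflexive on the whole type, hence the restriction to the carrier.\<close>

definition comb_order :: "nat \<Rightarrow> nat \<Rightarrow> nat rel" where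
  "comb_order s t = Restr ((comb_spine s t \<union> comb_teeth s t)\<^sup>*) (comb_carrier s t)"

lemma partial_order_on_comb: "partial_order_on (comb_carrier s t) (comb_order s t)"
proof -
  let ?g = "comb_spine s t \<union> comb_teeth s t"
  have le: "a \<le> b" if "(a, b) \<in> ?g\<^sup>*" for a b
    using that by (induction rule: rtrancl_induct) (auto simp: comb_spine_def comb_teeth_def)
  have "trans (comb_order s t)"
    unfolding comb_order_def by (auto intro!: transI elim: rtrancl_trans)
  moreover have "antisym (comb_order s t)"
    unfolding comb_order_def by (auto intro!: antisymI dest!: le)
  ultimately show ?thesis
    by (auto simp: partial_order_on_def preorder_on_def refl_on_def comb_order_def)
qed

lemma comb_generators_subset:
  assumes "1 \<le> t"
  shows "comb_spine s t \<union> comb_teeth s t \<subseteq> comb_carrier s t \<times> comb_carrier s t"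
proof -
  have *: "c * t + j \<le> s * t" if "c + 1 \<le> s" "j \<le> t" for c j
    using mult_le_mono1[OF that(1), of t] that(2) by simp
  show ?thesis
    using * assms *[of "Suc _" 1] by (fastforce simp: comb_spine_def comb_teeth_def comb_carrier_def)
qed

end

theory Submission
  imports Defs
begin

text \<open>
  Let \<open>m\<close> be the least element of the last tooth and \<open>v\<close> a \<open>231\<close>-avoiding linear extension.
  As the last tooth consists of the largest entries and occurs in increasing order, all its
  elements but \<open>m\<close> sit at the end of \<open>v\<close> (otherwise \<open>m\<close>, one of them and a later smaller entry
  form a \<open>231\<close>), and every entry before \<open>m\<close> is smaller than every non-tooth entry after \<open>m\<close>.
  Deleting the tooth leaves an extension \<open>u\<close> of the smaller comb, and \<open>m\<close> has been inserted after
  a prefix of \<open>u\<close> with entries \<open>{1..k}\<close>. Since \<open>u\<close> itself ends with its last tooth minus the least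
  element \<open>l\<close>, such a prefix exists for every \<open>k \<ge> l\<close>, so there are \<open>t\<close> insertion places.
\<close>

section \<open>Avoidance of 231 as a recursion on lists\<close>

fun avoids_231 :: "'a::linorder list \<Rightarrow> bool" where
  "avoids_231 [] \<longleftrightarrow> True"
| "avoids_231 (x # xs) \<longleftrightarrow> sorted_wrt (\<lambda>y z. \<not> (z < x \<and> x < y)) xs \<and> avoids_231 xs"

text \<open>A 231 cut in two has either its 2 alone on the left or both its 2 and its 3; the two
  quantified conditions exclude these cases.\<close>

lemma avoids_231_append:
  "avoids_231 (xs @ ys) \<longleftrightarrow> avoids_231 xs \<and> avoids_231 ys \<and>
     (\<forall>x\<in>set xs. sorted_wrt (\<lambda>y z. \<not> (z < x \<and> x < y)) ys) \<and>
     (\<forall>z\<in>set ys. sorted_wrt (\<lambda>x y. \<not> (z < x \<and> x < y)) xs)"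
  by (induction xs) (auto simp: sorted_wrt_append)

lemma avoids_231_sorted: "sorted xs \<Longrightarrow> avoids_231 xs"
proof (induction xs)
  case (Cons x xs)
  have "sorted_wrt (\<lambda>y z. \<not> (z < x \<and> x < y)) xs"
    by (rule sorted_wrt_mono_rel[of _ "(\<le>)"]) (use Cons.prems in auto)
  with Cons show ?case by simp
qed simp

lemma avoids_231_iff_nth:
  "avoids_231 v \<longleftrightarrow>
     (\<forall>i j k. i < j \<and> j < k \<and> k < length v \<longrightarrow> \<not> (v ! k < v ! i \<and> v ! i < v ! j))"
proof (induction v)
  case (Cons x v)
  have *: "(\<forall>i j k. i < j \<and> j < k \<and> k < length (x # v) \<longrightarrow> P i j k) \<longleftrightarrow>
      (\<forall>j k. j < k \<and> k < length v \<longrightarrow> P 0 (Suc j) (Suc k)) \<and>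
      (\<forall>i j k. i < j \<and> j < k \<and> k < length v \<longrightarrow> P (Suc i) (Suc j) (Suc k))"
    (is "?L \<longleftrightarrow> ?R") for P
  proof
    assume R: ?R
    show ?L
    proof (intro allI impI)
      fix i j k assume ijk: "i < j \<and> j < k \<and> k < length (x # v)"
      then obtain j' k' where "j = Suc j'" "k = Suc k'" by (metis less_imp_Suc_add)
      with R ijk show "P i j k" by (cases i) auto
    qed
  qed auto
  show ?case
    unfolding * using Cons by (auto simp: sorted_wrt_iff_nth_less)
qed simp

lemma same_relative_order_231:
  "same_relative_order [x, y, z] [2, 3, 1 :: nat] \<longleftrightarrow> z < x \<and> x < (y :: 'a::linorder)"
  by (auto simp: same_relative_order_def All_less_Suc numeral_3_eq_3)

lemma avoids_pattern_231_iff: "avoids_pattern v [2, 3, 1] \<longleftrightarrow> avoids_231 v"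
  unfolding contains_pattern_def avoids_231_iff_nth same_relative_order_231 by blast

section \<open>Linear extensions and generating relations\<close>

lemma linear_extensions_iff_sorted_wrt:
  "v \<in> linear_extensions A r \<longleftrightarrow> distinct v \<and> set v = A \<and> sorted_wrt (\<lambda>a b. (b, a) \<notin> r) v"
proof -
  have "(\<forall>i<n. \<forall>j<n. P i j \<longrightarrow> i \<le> j) \<longleftrightarrow> (\<forall>i j. i < j \<longrightarrow> j < n \<longrightarrow> \<not> P j i)"
    for n :: nat and P
    by (meson leD leI order.strict_trans)
  then show ?thesis
    unfolding linear_extensions_def sorted_wrt_iff_nth_less by simp
qed

text \<open>Positions increase along every generating step, and all members of a chain have
  positions because \<open>g\<close> stays within \<open>A\<close>. So only spine and tooth
  relations have to be checked later.\<close>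

lemma linear_extensions_closure:
  assumes "g \<subseteq> A \<times> A"
  shows "linear_extensions A (Restr (g\<^sup>*) A) = linear_extensions A g"
proof (intro equalityI subsetI)
  fix v assume "v \<in> linear_extensions A (Restr (g\<^sup>*) A)"
  then show "v \<in> linear_extensions A g"
    using r_into_rtrancl assms unfolding linear_extensions_def mem_Collect_eq by blast
next
  fix v assume v: "v \<in> linear_extensions A g"
  have "i \<le> j" if "(a, b) \<in> g\<^sup>*" "a = v ! i" "b = v ! j" "i < length v" "j < length v" for a b i j
    using that
  proof (induction arbitrary: j rule: rtrancl_induct)
    case base
    then show ?case using v by (auto simp: linear_extensions_def nth_eq_iff_index_eq)
  next
    case (step y z)
    from step.hyps(2) assms have "y \<in> set v" using v by (auto simp: linear_extensions_def)
    then obtain h where h: "h < length v" "v ! h = y" by (auto simp: in_set_conv_nth)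
    then have "h \<le> j" using v step by (auto simp: linear_extensions_def)
    moreover have "i \<le> h"
      using step.IH[OF step.prems(1) h(2)[symmetric] step.prems(3) h(1)] .
    ultimately show ?case by simp
  qed
  then show "v \<in> linear_extensions A (Restr (g\<^sup>*) A)"
    using v by (auto simp: linear_extensions_def)
qed

text \<open>The head must be \<open>a\<close>: otherwise its predecessor would lie in the tail,
  hence after its own successor. This serves to show that a tooth occurs in increasing
  order.\<close>

lemma eq_upt_if_successors_follow:
  assumes "distinct w" "set w = {a..<b}" "sorted_wrt (\<lambda>x y. x \<noteq> Suc y) w"
  shows "w = [a..<b]"
  using assms
proof (induction w arbitrary: a)
  case (Cons x w)
  have x: "x \<in> {a..<b}" using Cons.prems by auto
  have "x = a"
  proof (rule ccontr)
    assume "x \<noteq> a"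
    then have *: "x = Suc (x - 1)" "x - 1 \<in> {a..<b}" using x by auto
    then have "x - 1 \<in> set w" unfolding Cons.prems(2)[symmetric] by auto
    then have "x \<noteq> Suc (x - 1)" using Cons.prems(3) by simp
    then show False using *(1) by contradiction
  qed
  moreover have "set w = {Suc a..<b}"
  proof -
    have "set w = set (x # w) - {x}" using Cons.prems(1) by simp
    also have "\<dots> = {Suc a..<b}" unfolding Cons.prems(2) using \<open>x = a\<close> by auto
    finally show ?thesis .
  qed
  ultimately show ?case
    using Cons x by (simp add: upt_conv_Cons)
qed simp

section \<open>Generators of combs with a fixed tooth length\<close>

locale comb =
  fixes t :: nat
  assumes t_pos: "1 \<le> t"
begin

definition gens :: "nat \<Rightarrow> nat rel" where
  "gens s = comb_spine s t \<union> comb_teeth s t"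

lemma gens_less: "(a, b) \<in> gens s \<Longrightarrow> a < b"
  using t_pos by (auto simp: gens_def comb_spine_def comb_teeth_def)

lemma gens_le: "(a, b) \<in> gens s \<Longrightarrow> b \<le> s * t"
  using comb_generators_subset[OF t_pos, of s] by (auto simp: gens_def comb_carrier_def)

lemma gens_mono: "gens s \<subseteq> gens (Suc s)"
  by (force simp: gens_def comb_spine_def comb_teeth_def)

lemma gens_tooth: "s * t < a \<Longrightarrow> a < s * t + t \<Longrightarrow> (a, Suc a) \<in> gens (Suc s)"
  unfolding gens_def comb_teeth_def
  by (intro UnI2 CollectI, rule exI[of _ s], rule exI[of _ "a - s * t"]) auto

lemma gens_spine: "(Suc (s * t), Suc (Suc s * t)) \<in> gens (Suc (Suc s))"
  by (auto simp: gens_def comb_spine_def intro!: exI[of _ s])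

text \<open>A generator absent from the smaller comb has the largest admissible index
  \<open>c\<close>: \<open>s\<close> on the spine, linking the last two tooth minima, or
  \<open>Suc s\<close> in a tooth, where its source exceeds \<open>Suc s * t\<close>.\<close>

lemma gens_SucD:
  assumes "(a, b) \<in> gens (Suc (Suc s))"
  shows "(a, b) \<in> gens (Suc s) \<or> a = Suc (s * t) \<and> b = Suc (Suc s * t) \<or> Suc s * t < a"
proof -
  from assms consider "(a, b) \<in> comb_spine (Suc (Suc s)) t" | "(a, b) \<in> comb_teeth (Suc (Suc s)) t"
    unfolding gens_def by blast
  then show ?thesis
  proof cases
    case 1
    then obtain c where c: "a = c * t + 1" "b = (c + 1) * t + 1" "c + 2 \<le> Suc (Suc s)"
      by (auto simp: comb_spine_def)
    show ?thesis
    proof (cases "c = s")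
      case False
      with c show ?thesis by (fastforce simp: gens_def comb_spine_def)
    qed (use c in auto)
  next
    case 2
    then obtain c j where c: "a = c * t + j" "b = c * t + j + 1" "c + 1 \<le> Suc (Suc s)"
        "1 \<le> j" "j + 1 \<le> t"
      by (auto simp: comb_teeth_def)
    show ?thesis
    proof (cases "c = Suc s")
      case False
      with c have "c + 1 \<le> Suc s" by simp
      with c show ?thesis unfolding gens_def comb_teeth_def by blast
    qed (use c in auto)
  qed
qed

section \<open>Shape of an avoiding extension around its last tooth\<close>

definition exts :: "nat \<Rightarrow> nat list set" where
  "exts s = {v. distinct v \<and> set v = {1..s * t} \<and> sorted_wrt (\<lambda>a b. (b, a) \<notin> gens s) v \<and>
     avoids_231 v}"

lemma exts_eq:
  "{v \<in> linear_extensions (comb_carrier s t) (comb_order s t). avoids_pattern v [2, 3, 1]} = exts s"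
  unfolding avoids_pattern_231_iff comb_order_def
    linear_extensions_closure[OF comb_generators_subset[OF t_pos]]
  unfolding linear_extensions_iff_sorted_wrt exts_def gens_def comb_carrier_def by auto

text \<open>Avoidance is used twice. With \<open>m\<close> as the 2, nothing below \<open>m\<close>
  can follow another element of the last tooth; with \<open>m\<close> as the 3, no entry of
  \<open>xs\<close> can exceed one of \<open>ys\<close>.\<close>

lemma exts_SucE:
  assumes "v \<in> exts (Suc s)"
  defines "m \<equiv> Suc (s * t)"
  obtains xs ys where
    "v = xs @ m # ys @ [Suc m..<m + t]" "set (xs @ ys) = {1..<m}"
    "\<forall>x\<in>set xs. \<forall>y\<in>set ys. x < y"
proof -
  have v: "distinct v" "set v = {1..<m + t}" "sorted_wrt (\<lambda>a b. (b, a) \<notin> gens (Suc s)) v"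
      "avoids_231 v"
    using assms(1) atLeastLessThanSuc_atLeastAtMost[of 1 "Suc s * t"]
    by (auto simp: exts_def m_def add.commute)
  let ?big = "filter ((\<le>) m)"
  have "?big v = [m..<m + t]"
  proof (rule eq_upt_if_successors_follow)
    show "sorted_wrt (\<lambda>x y. x \<noteq> Suc y) (?big v)"
    proof (rule sorted_wrt_mono_rel)
      show "sorted_wrt (\<lambda>a b. (b, a) \<notin> gens (Suc s)) (?big v)"
        using v(3) by (rule sorted_wrt_filter)
    next
      fix x y assume "x \<in> set (?big v)" "y \<in> set (?big v)" "(y, x) \<notin> gens (Suc s)"
      then show "x \<noteq> Suc y"
        using gens_tooth[of s y] v(2) by (auto simp: m_def)
    qed
  qed (use v in \<open>auto simp: m_def\<close>)
  then have big: "?big v = m # [Suc m..<m + t]"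
    using t_pos by (simp add: upt_conv_Cons)
  have "m \<in> set v" using v(2) t_pos by (auto simp: m_def)
  then obtain xs zs where vz: "v = xs @ m # zs" by (meson split_list)
  \<comment> \<open>\<open>m\<close> comes first among the tooth elements, so one inside
    \<open>xs\<close> would give a second occurrence of \<open>m\<close>.\<close>
  have xs: "?big xs = []"
  proof (cases "?big xs")
    case (Cons x ws)
    then have "x = m" using big vz by simp
    moreover have "x \<in> set (?big xs)" using Cons by simp
    ultimately show ?thesis using v(1) vz by auto
  qed
  \<comment> \<open>The cut is at the first further tooth element after \<open>m\<close>, if there
    is one.\<close>
  define ys where "ys = takeWhile (\<lambda>x. x < m) zs"
  define ws where "ws = dropWhile (\<lambda>x. x < m) zs"
  have zs: "zs = ys @ ws" by (simp add: ys_def ws_def)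
  have ys: "\<forall>y\<in>set ys. y < m" by (auto simp: ys_def dest: set_takeWhileD)
  have "\<forall>w\<in>set ws. m \<le> w"
  proof (cases ws)
    case (Cons w ws')
    have "m \<le> w" using Cons hd_dropWhile[of "\<lambda>x. x < m" zs] by (simp add: ws_def)
    moreover have "w \<noteq> m" using v(1) vz zs Cons by auto
    ultimately have "m < w" by simp
    \<comment> \<open>An entry below \<open>m\<close> after \<open>w\<close> would complete
      \<open>m\<close>, \<open>w\<close> to a 231.\<close>
    then show ?thesis
      using v(4) by (auto simp: vz zs Cons not_less avoids_231_append sorted_wrt_append)
  qed simp
  then have "?big ws = ws" by simp
  moreover have "?big ys = []" using ys by (auto simp: filter_empty_conv)
  ultimately have ws: "ws = [Suc m..<m + t]"
    using big xs by (simp add: vz zs)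
  have ltm: "\<forall>x\<in>set xs. x < m" using xs by (auto simp: filter_empty_conv)
  show ?thesis
  proof
    show "v = xs @ m # ys @ [Suc m..<m + t]" by (simp add: vz zs ws)
    have "set (xs @ ys) = {x \<in> set v. x < m}"
      using ltm ys by (auto simp: vz zs ws)
    then show "set (xs @ ys) = {1..<m}" using v(2) by auto
    show "\<forall>x\<in>set xs. \<forall>y\<in>set ys. x < y"
    proof (intro ballI)
      fix x y assume xy: "x \<in> set xs" "y \<in> set ys"
      have "x \<noteq> y" using v(1) xy by (auto simp: vz zs)
      \<comment> \<open>Otherwise \<open>x\<close>, \<open>m\<close>, \<open>y\<close> form a
        231.\<close>
      moreover have "\<not> y < x" using v(4) xy ltm by (auto simp: vz zs avoids_231_append)
      ultimately show "x < y" by simp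
    qed
  qed
qed

text \<open>By \<open>exts_SucE\<close>, \<open>u\<close> is an arrangement of
  \<open>{1..Suc (s * t)}\<close> followed by an increasing run of consecutive numbers; cutting
  anywhere from the start of this run on leaves an initial interval on the left.\<close>

lemma exts_prefix:
  assumes "u \<in> exts (Suc s)" "Suc (s * t) \<le> k" "k \<le> Suc s * t"
  shows "set (take k u) = {1..k}" "set (drop k u) = {Suc k..Suc s * t}"
proof -
  let ?l = "Suc (s * t)"
  obtain xs ys where u: "u = xs @ ?l # ys @ [Suc ?l..<?l + t]" "set (xs @ ys) = {1..<?l}"
    by (rule exts_SucE[OF assms(1)]) (rule that)
  have d: "distinct u" and su: "set u = {1..Suc s * t}" using assms(1) by (auto simp: exts_def)
  define p where "p = xs @ ?l # ys"
  have p: "u = p @ [Suc ?l..<?l + t]" by (simp add: p_def u(1))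
  have "set p = insert ?l (set (xs @ ys))" by (auto simp: p_def)
  also have "\<dots> = {1..?l}" unfolding u(2) by auto
  finally have sp: "set p = {1..?l}" .
  have len: "length p = ?l"
    using d distinct_card[of p] by (simp add: p sp)
  have "take k u = p @ [Suc ?l..<Suc k]"
    using assms len by (simp add: p take_upt del: upt_Suc)
  then have "set (take k u) = {1..?l} \<union> {Suc ?l..<Suc k}" by (simp add: sp del: upt_Suc)
  also have "\<dots> = {1..k}" using assms(2) by auto
  finally show *: "set (take k u) = {1..k}" .
  have "set (take k u) \<union> set (drop k u) = set u"
    by (metis append_take_drop_id set_append)
  moreover have "set (take k u) \<inter> set (drop k u) = {}"
    using d by (metis append_take_drop_id distinct_append)
  ultimately have "set (drop k u) = set u - set (take k u)" by blast
  also have "\<dots> = {Suc k..Suc s * t}" unfolding * su by auto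
  finally show "set (drop k u) = {Suc k..Suc s * t}" .
qed

section \<open>Inserting and deleting the last tooth\<close>

text \<open>This is the shape forced by \<open>exts_SucE\<close>: only the place of the least tooth
  element remains free.\<close>

definition add_tooth :: "nat \<Rightarrow> nat list \<Rightarrow> nat \<Rightarrow> nat list" where
  "add_tooth m u k = take k u @ m # drop k u @ [Suc m..<m + t]"

text \<open>The lower bound on \<open>k\<close> puts the previous tooth minimum before
  \<open>m\<close>, as the spine demands. By \<open>exts_prefix\<close> it also keeps the entries
  before \<open>m\<close> below the old entries after it, so \<open>m\<close> is never the 3 of a
  231.\<close>

lemma add_tooth_in_exts:
  assumes "u \<in> exts (Suc s)" "Suc (s * t) \<le> k" "k \<le> Suc s * t"
  shows "add_tooth (Suc (Suc s * t)) u k \<in> exts (Suc (Suc s))"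
proof -
  define m where "m = Suc (Suc s * t)"
  define xs where "xs = take k u"
  define ys where "ys = drop k u"
  have u: "u = xs @ ys" by (simp add: xs_def ys_def)
  have sets: "set xs = {1..k}" "set ys = {Suc k..<m}"
    using exts_prefix[OF assms] by (auto simp: xs_def ys_def m_def)
  have k: "Suc (s * t) \<le> k" "k < m" using assms by (auto simp: m_def)
  have d: "distinct xs" "distinct ys" and av: "avoids_231 (xs @ ys)"
    and so: "sorted_wrt (\<lambda>a b. (b, a) \<notin> gens (Suc s)) (xs @ ys)"
    using assms(1) by (auto simp: exts_def u)
  let ?T = "[Suc m..<m + t]"
  let ?v = "xs @ m # ys @ ?T"
  have "distinct ?v" using d sets k by auto
  moreover have "set ?v = {1..Suc (Suc s) * t}"
  proof -
    have "Suc (Suc s) * t = m + t - 1" by (simp add: m_def)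
    then show ?thesis using sets k t_pos by auto
  qed
  moreover have "sorted_wrt (\<lambda>a b. (b, a) \<notin> gens (Suc (Suc s))) ?v"
  proof -
    have old: "(b, a) \<notin> gens (Suc (Suc s))"
      if "(b, a) \<notin> gens (Suc s)" "a < m" "b < m" for a b
      using gens_SucD[of b a s] that by (auto simp: m_def)
    have inc: "(b, a) \<notin> gens (Suc (Suc s))" if "a \<le> b" for a b
      using gens_less[of b a] that by fastforce
    \<comment> \<open>The only generator ending in \<open>m\<close> starts at
      \<open>Suc (s * t)\<close>, which lies in \<open>xs\<close>.\<close>
    have spine: "(y, m) \<notin> gens (Suc (Suc s))" if "y \<in> set ys" for y
      using gens_SucD[of y m s] gens_le[of y m "Suc s"] that sets k by (auto simp: m_def)
    have "sorted_wrt (\<lambda>a b. (b, a) \<notin> gens (Suc (Suc s))) (xs @ ys)"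
    proof (rule sorted_wrt_mono_rel[OF _ so])
      fix a b assume "a \<in> set (xs @ ys)" "b \<in> set (xs @ ys)" "(b, a) \<notin> gens (Suc s)"
      then show "(b, a) \<notin> gens (Suc (Suc s))" using sets k by (intro old) auto
    qed
    moreover have "sorted_wrt (\<lambda>a b. (b, a) \<notin> gens (Suc (Suc s))) ?T"
      by (rule sorted_wrt_mono_rel[OF _ sorted_upt]) (rule inc)
    ultimately show ?thesis
      using sets k by (auto simp: sorted_wrt_append inc spine)
  qed
  moreover have "avoids_231 ?v"
  proof -
    \<comment> \<open>The remaining conditions compare values from separate intervals, so within a
      block they hold for all pairs in either order.\<close>
    have triv: "sorted_wrt R zs" if "\<And>x y. x \<in> set zs \<Longrightarrow> y \<in> set zs \<Longrightarrow> R x y"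
      for R :: "nat \<Rightarrow> nat \<Rightarrow> bool" and zs
      using that by (induction zs) auto
    show ?thesis
      using av sets k avoids_231_sorted[OF sorted_upt, of "Suc m" "m + t"]
      by (auto simp: avoids_231_append sorted_wrt_append intro!: triv)
  qed
  ultimately show ?thesis
    unfolding exts_def add_tooth_def m_def xs_def ys_def by blast
qed

text \<open>For the inclusion into the image, delete the last tooth. The spine puts
  \<open>Suc (s * t)\<close> before \<open>m\<close>, and all smaller numbers come along because
  \<open>xs\<close> lies below \<open>ys\<close>; this gives the lower end of the range of
  \<open>k\<close>.\<close>

lemma exts_Suc_Suc:
  "exts (Suc (Suc s)) =
     (\<lambda>(u, k). add_tooth (Suc (Suc s * t)) u k) ` (exts (Suc s) \<times> {Suc (s * t)..Suc s * t})"
  (is "_ = ?f ` ?D")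
proof (intro equalityI subsetI)
  fix v assume vin: "v \<in> exts (Suc (Suc s))"
  define m where "m = Suc (Suc s * t)"
  obtain xs ys where
    v: "v = xs @ m # ys @ [Suc m..<m + t]" and sets: "set (xs @ ys) = {1..<m}"
    and less: "\<forall>x\<in>set xs. \<forall>y\<in>set ys. x < y"
    unfolding m_def by (rule exts_SucE[OF vin])
  have d: "distinct v" and so: "sorted_wrt (\<lambda>a b. (b, a) \<notin> gens (Suc (Suc s))) v"
    and av: "avoids_231 v"
    using vin by (auto simp: exts_def)
  have "sorted_wrt (\<lambda>a b. (b, a) \<notin> gens (Suc (Suc s))) (xs @ ys)"
    using so by (auto simp: v sorted_wrt_append)
  then have "sorted_wrt (\<lambda>a b. (b, a) \<notin> gens (Suc s)) (xs @ ys)"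
    by (rule sorted_wrt_mono_rel[rotated]) (use gens_mono in blast)
  moreover have "avoids_231 (xs @ ys)"
    using av by (auto simp: v avoids_231_append sorted_wrt_append)
  moreover have "{1..<m} = {1..Suc s * t}" by (auto simp: m_def)
  ultimately have u: "xs @ ys \<in> exts (Suc s)"
    using d sets by (auto simp: exts_def v)
  have lin: "Suc (s * t) \<in> set xs"
  proof (rule ccontr)
    assume "Suc (s * t) \<notin> set xs"
    moreover have "Suc (s * t) \<in> set (xs @ ys)"
      unfolding sets using t_pos by (auto simp: m_def)
    ultimately have "Suc (s * t) \<in> set ys" by simp
    then show False using so gens_spine[of s] by (auto simp: v sorted_wrt_append m_def)
  qed
  have "{1..Suc (s * t)} \<subseteq> set xs"
  proof
    fix x assume x: "x \<in> {1..Suc (s * t)}"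
    then have "x \<in> set (xs @ ys)" unfolding sets using t_pos by (auto simp: m_def)
    moreover have "x \<notin> set ys" using less lin x by force
    ultimately show "x \<in> set xs" by simp
  qed
  \<comment> \<open>The insertion place is \<open>length xs\<close>, so bounding the number of
    entries of \<open>xs\<close> bounds \<open>k\<close>.\<close>
  then have "Suc (s * t) \<le> card (set xs)"
    using card_mono[of "set xs" "{1..Suc (s * t)}"] by simp
  moreover have "card (set xs) \<le> card {1..<m}"
    unfolding sets[symmetric] by (intro card_mono) auto
  ultimately have "length xs \<in> {Suc (s * t)..Suc s * t}"
    using d by (simp add: v distinct_card m_def)
  moreover have "v = ?f (xs @ ys, length xs)"
    by (simp add: v add_tooth_def m_def)
  ultimately show "v \<in> ?f ` ?D" using u by blast
qed (auto simp: add_tooth_in_exts simp del: mult_Suc)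

text \<open>Discarding the entries from \<open>m\<close> upwards recovers \<open>u\<close>, and
  counting the entries in front of \<open>m\<close> recovers \<open>k\<close>.\<close>

lemma inj_on_add_tooth:
  "inj_on (\<lambda>(u, k). add_tooth (Suc (Suc s * t)) u k) (exts (Suc s) \<times> {Suc (s * t)..Suc s * t})"
proof -
  define m where "m = Suc (Suc s * t)"
  have rec: "filter (\<lambda>x. x < m) (add_tooth m u k) = u"
      "length (takeWhile (\<lambda>x. x \<noteq> m) (add_tooth m u k)) = k"
    if "u \<in> exts (Suc s)" "k \<le> Suc s * t" for u k
  proof -
    have su: "set u = {1..<m}" and d: "distinct u"
      using that by (simp_all add: exts_def m_def atLeastLessThanSuc_atLeastAtMost del: mult_Suc)
    have lt: "\<forall>x\<in>set (take k u). x < m" "\<forall>x\<in>set (drop k u). x < m"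
      using su by (auto dest: in_set_takeD in_set_dropD)
    have "filter (\<lambda>x. x < m) [Suc m..<m + t] = []" by (auto simp: filter_empty_conv)
    moreover have "filter (\<lambda>x. x < m) (take k u) = take k u"
      "filter (\<lambda>x. x < m) (drop k u) = drop k u" using lt by (simp_all add: filter_id_conv)
    ultimately show "filter (\<lambda>x. x < m) (add_tooth m u k) = u"
      by (simp add: add_tooth_def)
    have "takeWhile (\<lambda>x. x \<noteq> m) (add_tooth m u k) = take k u"
      unfolding add_tooth_def using lt by (subst takeWhile_append2) auto
    moreover have "length u = Suc s * t" using distinct_card[OF d] su by (simp add: m_def)
    ultimately show "length (takeWhile (\<lambda>x. x \<noteq> m) (add_tooth m u k)) = k"
      using that by simp
  qed
  show ?thesis
    unfolding m_def[symmetric] 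
    by (rule inj_on_inverseI[where g = "\<lambda>v. (filter (\<lambda>x. x < m) v, length (takeWhile (\<lambda>x. x \<noteq> m) v))"])
      (auto simp: rec simp del: mult_Suc)
qed

section \<open>Counting\<close>

lemma exts_1: "exts (Suc 0) = {[1..<Suc t]}"
proof -
  have "v = [1..<Suc t]" if v: "v \<in> exts (Suc 0)" for v
  proof -
    from exts_SucE[OF v] obtain xs ys where
      "v = xs @ 1 # ys @ [Suc 1..<1 + t]" "set (xs @ ys) = {1..<1}" by auto
    then show ?thesis using t_pos by (simp add: upt_conv_Cons)
  qed
  moreover have "sorted_wrt (\<lambda>a b. (b, a) \<notin> gens (Suc 0)) [1..<Suc t]"
    by (rule sorted_wrt_mono_rel[OF _ sorted_upt]) (use gens_less in fastforce)
  then have "[1..<Suc t] \<in> exts (Suc 0)"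
    using avoids_231_sorted[OF sorted_upt, of 1 "Suc t"] by (auto simp: exts_def simp del: upt_Suc)
  ultimately show ?thesis by blast
qed

text \<open>Every tooth after the first contributes a factor \<open>t\<close>, the size of
  \<open>{Suc (s * t)..Suc s * t}\<close>. The shift to \<open>Suc s\<close> starts the induction at
  a single tooth, which has no spine link.\<close>

lemma card_exts: "card (exts (Suc s)) = t ^ s"
proof (induction s)
  case (Suc s)
  show ?case
    unfolding exts_Suc_Suc card_image[OF inj_on_add_tooth]
    by (simp add: card_cartesian_product Suc)
qed (simp add: exts_1)

end

theorem theorem10:
  fixes s t :: nat
  assumes "1 \<le> s" and "1 \<le> t"
  shows "card {v \<in> linear_extensions (comb_carrier s t) (comb_order s t).
                 avoids_pattern v [2, 3, 1]} = t ^ (s - 1)"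
proof -
  interpret comb t by standard (fact assms(2))
  show ?thesis
    unfolding exts_eq using card_exts[of "s - 1"] assms(1) by simp
qed

end
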